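(* Let $r\colon X\to Y$ be a refinable map, where $X$ is a normal space and $Y$ is a paracompact space. If $X$ is $S$-weakly infinite-dimensional, then $Y$ is $S$-weakly infinite-dimensional.
   Context: All spaces are assumed to be normal and all maps are continuous. A space $X$ is $S$-weakly infinite-dimensional if for any sequence $\{(A_i,B_i)\}_{i\ge 1}$ of pairs of disjoint closed sets in $X$ (i.e. $A_i\cap B_i=\emptyset$ for each $i$) there exist closed separators $C_i$ between $A_i$ and $B_i$ such that $\bigcap_{i=1}^n C_i=\emptyset$ for some $n$. Here a closed set $C$ is a separator between $A$ and $B$ if $X\setminus C$ is the union of two disjoint open sets, one containing $A$ and the other containing $B$. For an open cover $\omega$ of $X$, a continuous map $f\colon X\to Y$ is called an $\omega$-map if there is an open cover $\gamma$ of $Y$ such that $f^{-1}(\gamma)=\{f^{-1}(G):G\in\gamma\}$ refines $\omega$. A surjective continuous map $r\colon X\to Y$ is called refinable if for any locally finite open cover $\omega$ of $X$ and any open cover $\gamma$ of $Y$ there exists a surjective $\omega$-map $f\colon X\to Y$ such that $r$ and $f$ are $\gamma$-close, i.e. for every $x\in X$ there is an element of $\gamma$ containing both $r(x)$ and $f(x)$. *)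

theory Defs
  imports "HOL-Analysis.Analysis"
begin

definition open_cover :: "'a topology \<Rightarrow> 'a set set \<Rightarrow> bool" where
  "open_cover X \<U> \<longleftrightarrow> (\<forall>U\<in>\<U>. openin X U) \<and> \<Union>\<U> = topspace X"

definition refines :: "'a set set \<Rightarrow> 'a set set \<Rightarrow> bool" where
  "refines \<V> \<U> \<longleftrightarrow> (\<forall>V\<in>\<V>. \<exists>U\<in>\<U>. V \<subseteq> U)"

text \<open>
  Like \<^const>\<open>normal_space\<close>, the following notion has no separation axiom built in.
  A reader for whom paracompact (normal) spaces are Hausdorff (T1) obtains that
  reading as a special case.
\<close>

definition paracompact_space :: "'a topology \<Rightarrow> bool" where
  "paracompact_space X \<longleftrightarrow>
     (\<forall>\<U>. open_cover X \<U> \<longrightarrow>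
        (\<exists>\<V>. open_cover X \<V> \<and> locally_finite_in X \<V> \<and> refines \<V> \<U>))"

definition separator :: "'a topology \<Rightarrow> 'a set \<Rightarrow> 'a set \<Rightarrow> 'a set \<Rightarrow> bool" where
  "separator X A B C \<longleftrightarrow>
     closedin X C \<and>
     (\<exists>U V. openin X U \<and> openin X V \<and> U \<inter> V = {} \<and>
            topspace X - C = U \<union> V \<and> A \<subseteq> U \<and> B \<subseteq> V)"

text \<open>Sequences are indexed from 1; the values at index 0 are irrelevant.\<close>

definition S_weakly_infinite_dimensional :: "'a topology \<Rightarrow> bool" where
  "S_weakly_infinite_dimensional X \<longleftrightarrow>
     (\<forall>A B :: nat \<Rightarrow> 'a set.
        (\<forall>i\<ge>1. closedin X (A i) \<and> closedin X (B i) \<and> A i \<inter> B i = {}) \<longrightarrow>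
        (\<exists>C. (\<forall>i\<ge>1. separator X (A i) (B i) (C i)) \<and>
             (\<exists>n\<ge>1. (\<Inter>i\<in>{1..n}. C i) = {})))"

definition surjective_map :: "'a topology \<Rightarrow> 'b topology \<Rightarrow> ('a \<Rightarrow> 'b) \<Rightarrow> bool" where
  "surjective_map X Y f \<longleftrightarrow> continuous_map X Y f \<and> f ` topspace X = topspace Y"

definition omega_map :: "'a topology \<Rightarrow> 'b topology \<Rightarrow> 'a set set \<Rightarrow> ('a \<Rightarrow> 'b) \<Rightarrow> bool" where
  "omega_map X Y \<omega> f \<longleftrightarrow>
     continuous_map X Y f \<and>
     (\<exists>\<gamma>. open_cover Y \<gamma> \<and> refines ((\<lambda>G. {x \<in> topspace X. f x \<in> G}) ` \<gamma>) \<omega>)"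

definition cover_close :: "'a topology \<Rightarrow> 'b set set \<Rightarrow> ('a \<Rightarrow> 'b) \<Rightarrow> ('a \<Rightarrow> 'b) \<Rightarrow> bool" where
  "cover_close X \<gamma> r f \<longleftrightarrow> (\<forall>x\<in>topspace X. \<exists>G\<in>\<gamma>. r x \<in> G \<and> f x \<in> G)"

definition refinable_map :: "'a topology \<Rightarrow> 'b topology \<Rightarrow> ('a \<Rightarrow> 'b) \<Rightarrow> bool" where
  "refinable_map X Y r \<longleftrightarrow>
     surjective_map X Y r \<and>
     (\<forall>\<omega> \<gamma>. open_cover X \<omega> \<and> locally_finite_in X \<omega> \<and> open_cover Y \<gamma> \<longrightarrow>
        (\<exists>f. surjective_map X Y f \<and> omega_map X Y \<omega> f \<and> cover_close X \<gamma> r f))"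

end

theory Submission
  imports Defs
begin

text \<open>
  Given disjoint closed pairs \<open>A i, B i\<close> in \<open>Y\<close>, thicken them to open sets \<open>U i\<close>, \<open>V i\<close> with
  disjoint closures, and pull these closures back along \<open>r\<close>. Since \<open>X\<close> is \<open>S\<close>-weakly
  infinite-dimensional, the pullbacks have separators of which finitely many, the first \<open>n\<close> say,
  have empty intersection. Their complements split into open sides \<open>P i\<close>, \<open>Q i\<close>, and the \<open>2n\<close>
  sets \<open>P i\<close>, \<open>Q i\<close> form a finite open cover \<open>\<omega>\<close> of \<open>X\<close>. From here on only the first \<open>n\<close>
  pairs matter; the remaining ones can be separated arbitrarily.

  Refinability is applied once, to \<open>\<omega>\<close> and to a cover of \<open>Y\<close> (from \<open>fine_open_cover\<close>)
  fine enough that a map \<open>f\<close> close to \<open>r\<close> sends into \<open>A i\<close> (into \<open>B i\<close>) only points that \<open>r\<close>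
  sends into \<open>U i\<close> (into \<open>V i\<close>), that is, points on the side \<open>P i\<close> (the side \<open>Q i\<close>). The map
  \<open>f\<close> obtained is an \<open>\<omega>\<close>-map, so \<open>Y\<close> is covered by open sets \<open>G i\<close>, \<open>H i\<close> whose preimages
  under \<open>f\<close> lie inside \<open>P i\<close> and \<open>Q i\<close> (\<open>omega_map_open_sides\<close>). Surjectivity of \<open>f\<close> carries
  the disjointness of \<open>P i\<close> and \<open>Q i\<close> down to \<open>Y\<close>: \<open>G i\<close> misses \<open>H i\<close> and \<open>B i\<close>, and
  \<open>H i\<close> misses \<open>A i\<close>. Now \<open>A i\<close> need not lie inside \<open>G i\<close>, but after shrinking the cover to
  closed sets one can separate \<open>A i\<close> together with the shrunken \<open>G i\<close> from \<open>B i\<close> together with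
  the shrunken \<open>H i\<close>. The \<open>i\<close>-th separator then misses the shrunken \<open>G i\<close> and \<open>H i\<close>; as these
  sets still cover \<open>Y\<close>, no point lies on all the separators (\<open>separators_from_open_sides\<close>).
\<close>

section \<open>Normal spaces\<close>

text \<open>
  The finite shrinking lemma. Covering an arbitrary closed set \<open>K\<close> rather than the whole space
  makes the induction go through: once the first set has been shrunk to a neighbourhood of the
  part of \<open>K\<close> that only it covers, the rest of \<open>K\<close> is a smaller closed set for the other sets.
\<close>

lemma normal_space_closed_shrinking:
  assumes "normal_space Y" "finite I" "\<And>i. i \<in> I \<Longrightarrow> openin Y (U i)"
    and "closedin Y K" "K \<subseteq> (\<Union>i\<in>I. U i)"
  shows "\<exists>F. (\<forall>i\<in>I. closedin Y (F i) \<and> F i \<subseteq> U i) \<and> K \<subseteq> (\<Union>i\<in>I. F i)"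
  using assms(2-5)
proof (induction I arbitrary: K rule: finite_induct)
  case empty
  then show ?case by auto
next
  case (insert j I)
  let ?L = "K - (\<Union>i\<in>I. U i)"
  have "closedin Y ?L" "openin Y (U j)" "?L \<subseteq> U j"
    using insert.prems by (auto intro!: closedin_diff openin_Union)
  then have "\<exists>W C. openin Y W \<and> closedin Y C \<and> ?L \<subseteq> W \<and> W \<subseteq> C \<and> C \<subseteq> U j"
    using assms(1) unfolding normal_space_alt
    by (metis closedin_closure_of closure_of_subset openin_subset)
  then obtain W C where W: "openin Y W" "closedin Y C" "?L \<subseteq> W" "W \<subseteq> C" "C \<subseteq> U j"
    by blast
  have "closedin Y (K - W)" "K - W \<subseteq> (\<Union>i\<in>I. U i)"
    using insert.prems W by (auto intro: closedin_diff)
  then obtain F where F: "\<forall>i\<in>I. closedin Y (F i) \<and> F i \<subseteq> U i" "K - W \<subseteq> (\<Union>i\<in>I. F i)"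
    using insert.IH insert.prems(1) by (metis insertI2)
  show ?case
  proof (intro exI conjI)
    show "\<forall>i\<in>insert j I. closedin Y ((F(j := C)) i) \<and> (F(j := C)) i \<subseteq> U i"
      using F(1) W by auto
    show "K \<subseteq> (\<Union>i\<in>insert j I. (F(j := C)) i)"
      using F(2) W(4) insert.hyps(2) by (fastforce split: if_splits)
  qed
qed

lemma normal_space_separator_avoiding:
  assumes "normal_space Y" "closedin Y A" "closedin Y B" "A \<inter> B = {}"
  obtains C where "separator Y A B C" "C \<inter> (A \<union> B) = {}"
proof -
  obtain U V where UV: "openin Y U" "openin Y V" "A \<subseteq> U" "B \<subseteq> V" "U \<inter> V = {}"
    using assms unfolding normal_space_def disjnt_def by metis
  show thesis
  proof
    have "topspace Y - (topspace Y - (U \<union> V)) = U \<union> V"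
      using openin_subset[OF UV(1)] openin_subset[OF UV(2)] by blast
    moreover have "closedin Y (topspace Y - (U \<union> V))"
      using UV by (intro closedin_diff) auto
    ultimately show "separator Y A B (topspace Y - (U \<union> V))"
      using UV unfolding separator_def by blast
    show "(topspace Y - (U \<union> V)) \<inter> (A \<union> B) = {}"
      using UV by blast
  qed
qed

lemma separator_mono:
  assumes "separator Y A' B' C" "A \<subseteq> A'" "B \<subseteq> B'"
  shows "separator Y A B C"
  using assms unfolding separator_def by (meson subset_trans)

section \<open>Covers and separators\<close>

text \<open>
  Any element of this cover that contains a point of some \<open>A i\<close> lies inside \<open>U i\<close>. A map that is
  close to \<open>r\<close> with respect to it therefore sends a point into \<open>A i\<close> only if \<open>r\<close> sends that point
  into \<open>U i\<close>.
\<close>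

lemma fine_open_cover:
  assumes "finite I" "\<And>i. i \<in> I \<Longrightarrow> closedin Y (A i)" "\<And>i. i \<in> I \<Longrightarrow> openin Y (U i)"
    and "\<And>i. i \<in> I \<Longrightarrow> A i \<subseteq> U i"
  shows "open_cover Y {G. openin Y G \<and> (\<forall>i\<in>I. G \<inter> A i = {} \<or> G \<subseteq> U i)}"
    (is "open_cover Y ?\<gamma>")
proof -
  have "\<exists>G\<in>?\<gamma>. y \<in> G" if "y \<in> topspace Y" for y
  proof -
    let ?N = "\<lambda>i. if y \<in> A i then U i else topspace Y - A i"
    let ?G = "topspace Y \<inter> (\<Inter>i\<in>I. ?N i)"
    have "openin Y ?G"
      using assms(1-3) by (intro openin_Int_Inter) auto
    moreover have "y \<in> ?G"
      using that assms(4) by auto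
    moreover have "?G \<inter> A i = {} \<or> ?G \<subseteq> U i" if "i \<in> I" for i
    proof -
      have "?G \<subseteq> ?N i"
        using that by blast
      then show ?thesis
        by (cases "y \<in> A i") auto
    qed
    ultimately show ?thesis
      by (intro bexI[of _ ?G] CollectI conjI ballI)
  qed
  then have "topspace Y \<subseteq> \<Union>?\<gamma>"
    by (meson UnionI subsetI)
  moreover have "\<Union>?\<gamma> \<subseteq> topspace Y"
    by (auto dest: openin_subset)
  ultimately show ?thesis
    unfolding open_cover_def by (intro conjI ballI equalityI) simp_all
qed

text \<open>
  In a covering by pairs of disjoint open sides, the sides need not contain the sets to be
  separated; it is enough that each side misses the opposite set. Shrinking the sides to closed
  sets makes room to absorb \<open>A i\<close> and \<open>B i\<close>, and the separators so obtained avoid a cover.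
\<close>

lemma separators_from_open_sides:
  assumes "normal_space Y" "finite I"
    and AB: "\<And>i. i \<in> I \<Longrightarrow> closedin Y (A i) \<and> closedin Y (B i) \<and> A i \<inter> B i = {}"
    and GH: "\<And>i. i \<in> I \<Longrightarrow> openin Y (G i) \<and> openin Y (H i) \<and> G i \<inter> H i = {}"
    and miss: "\<And>i. i \<in> I \<Longrightarrow> A i \<inter> H i = {} \<and> B i \<inter> G i = {}"
    and cover: "topspace Y \<subseteq> (\<Union>i\<in>I. G i \<union> H i)"
  shows "\<exists>C. (\<forall>i\<in>I. separator Y (A i) (B i) (C i)) \<and> topspace Y \<inter> (\<Inter>i\<in>I. C i) = {}"
proof -
  have "\<exists>F. (\<forall>i\<in>I. closedin Y (F i) \<and> F i \<subseteq> G i \<union> H i) \<and> topspace Y \<subseteq> (\<Union>i\<in>I. F i)"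
    using assms(1,2) GH cover by (intro normal_space_closed_shrinking) auto
  then obtain F where F: "\<And>i. i \<in> I \<Longrightarrow> closedin Y (F i) \<and> F i \<subseteq> G i \<union> H i"
    and Fcover: "topspace Y \<subseteq> (\<Union>i\<in>I. F i)"
    by blast
  have "\<exists>C. separator Y (A i) (B i) C \<and> C \<inter> F i = {}" if i: "i \<in> I" for i
  proof -
    (* F i splits into two closed parts because G i and H i are disjoint. *)
    have eq: "F i \<inter> G i = F i - H i" "F i \<inter> H i = F i - G i"
      using F[OF i] GH[OF i] by blast+
    have "closedin Y (A i \<union> (F i \<inter> G i))" "closedin Y (B i \<union> (F i \<inter> H i))"
      unfolding eq using F[OF i] GH[OF i] AB[OF i] by (auto intro: closedin_diff)
    moreover have "(A i \<union> (F i \<inter> G i)) \<inter> (B i \<union> (F i \<inter> H i)) = {}"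
      using AB[OF i] GH[OF i] miss[OF i] by blast
    ultimately obtain C where C: "separator Y (A i \<union> (F i \<inter> G i)) (B i \<union> (F i \<inter> H i)) C"
      "C \<inter> ((A i \<union> (F i \<inter> G i)) \<union> (B i \<union> (F i \<inter> H i))) = {}"
      using normal_space_separator_avoiding[OF assms(1)] by blast
    show ?thesis
      using separator_mono[OF C(1)] C(2) F[OF i] by blast
  qed
  then obtain C where C: "\<And>i. i \<in> I \<Longrightarrow> separator Y (A i) (B i) (C i) \<and> C i \<inter> F i = {}"
    by metis
  then show ?thesis
    using Fcover by (intro exI[of _ C]) blast
qed

text \<open>
  Open sides descend along an \<open>\<omega>\<close>-map: if the preimages of an open cover \<open>\<delta>\<close> of \<open>Y\<close> refine the
  sides, take for \<open>G i\<close> the union of all members of \<open>\<delta>\<close> with preimage inside \<open>P i\<close>, and likewise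
  for \<open>H i\<close>. A common point of \<open>G i\<close> and \<open>H i\<close> would lift, by surjectivity, to one of \<open>P i \<inter> Q i\<close>.
\<close>

lemma omega_map_open_sides:
  assumes f: "surjective_map X Y f" "omega_map X Y (P ` I \<union> Q ` I) f"
    and PQ: "\<And>i. i \<in> I \<Longrightarrow> P i \<inter> Q i = {}"
  shows "\<exists>G H. (\<forall>i\<in>I. openin Y (G i) \<and> openin Y (H i) \<and> G i \<inter> H i = {} \<and>
      {x \<in> topspace X. f x \<in> G i} \<subseteq> P i \<and> {x \<in> topspace X. f x \<in> H i} \<subseteq> Q i) \<and>
      topspace Y \<subseteq> (\<Union>i\<in>I. G i \<union> H i)"
proof -
  obtain \<delta> where \<delta>: "open_cover Y \<delta>"
    "refines ((\<lambda>D. {x \<in> topspace X. f x \<in> D}) ` \<delta>) (P ` I \<union> Q ` I)"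
    using f(2) unfolding omega_map_def by blast
  define S where "S = (\<lambda>W. \<Union>{D \<in> \<delta>. {x \<in> topspace X. f x \<in> D} \<subseteq> W})"
  have open_S: "openin Y (S W)" for W
    using \<delta>(1) unfolding S_def open_cover_def by blast
  have pre: "{x \<in> topspace X. f x \<in> S W} \<subseteq> W" for W
    unfolding S_def by blast
  have "S (P i) \<inter> S (Q i) = {}" if "i \<in> I" for i
  proof (rule ccontr)
    assume "S (P i) \<inter> S (Q i) \<noteq> {}"
    then obtain y where y: "y \<in> S (P i)" "y \<in> S (Q i)" by blast
    then have "y \<in> f ` topspace X"
      using f(1) openin_subset[OF open_S] unfolding surjective_map_def by blast
    then obtain x where "x \<in> topspace X" "f x = y"
      by blast
    then show False
      using y pre[of "P i"] pre[of "Q i"] PQ[OF that] by blast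
  qed
  moreover have "topspace Y \<subseteq> (\<Union>i\<in>I. S (P i) \<union> S (Q i))"
  proof
    fix y assume "y \<in> topspace Y"
    then obtain D where D: "D \<in> \<delta>" "y \<in> D"
      using \<delta>(1) unfolding open_cover_def by blast
    then obtain W where W: "W \<in> P ` I \<union> Q ` I" "{x \<in> topspace X. f x \<in> D} \<subseteq> W"
      using \<delta>(2) unfolding refines_def by (meson imageI)
    with D have "y \<in> S W"
      unfolding S_def by blast
    with W(1) show "y \<in> (\<Union>i\<in>I. S (P i) \<union> S (Q i))" by blast
  qed
  ultimately show ?thesis
    using open_S pre
    by (intro exI[of _ "\<lambda>i. S (P i)"] exI[of _ "\<lambda>i. S (Q i)"] conjI ballI) auto
qed

section \<open>Refinable maps\<close>

text \<open>
  One \<open>f\<close> near \<open>r\<close> serves all the pairs at once: finiteness of \<open>I\<close> makes the cover of \<open>X\<close> by the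
  sides locally finite and lets \<open>fine_open_cover\<close> treat all pairs simultaneously. Surjectivity
  turns the implications from \<open>f x \<in> A i\<close> to \<open>x \<in> P i\<close> and from \<open>f x \<in> H i\<close> to \<open>x \<in> Q i\<close> into
  the disjointness of \<open>A i\<close> and \<open>H i\<close>.
\<close>

lemma refinable_map_finite_separators:
  assumes "normal_space Y" "refinable_map X Y r" "finite I"
    and AB: "\<And>i. i \<in> I \<Longrightarrow> closedin Y (A i) \<and> closedin Y (B i) \<and> A i \<inter> B i = {}"
    and UV: "\<And>i. i \<in> I \<Longrightarrow> openin Y (U i) \<and> openin Y (V i) \<and> A i \<subseteq> U i \<and> B i \<subseteq> V i"
    and PQ: "\<And>i. i \<in> I \<Longrightarrow> openin X (P i) \<and> openin X (Q i) \<and> P i \<inter> Q i = {}"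
    and pre: "\<And>i. i \<in> I \<Longrightarrow> {x \<in> topspace X. r x \<in> U i} \<subseteq> P i \<and> {x \<in> topspace X. r x \<in> V i} \<subseteq> Q i"
    and cover: "topspace X \<subseteq> (\<Union>i\<in>I. P i \<union> Q i)"
  shows "\<exists>C. (\<forall>i\<in>I. separator Y (A i) (B i) (C i)) \<and> topspace Y \<inter> (\<Inter>i\<in>I. C i) = {}"
proof -
  (* One cover handles the A i and the B i together: index the 2n closed sets by I \<times> bool. *)
  let ?A = "\<lambda>(i, b). if b then A i else B i" and ?U = "\<lambda>(i, b). if b then U i else V i"
  let ?\<gamma> = "{G. openin Y G \<and> (\<forall>k\<in>I \<times> (UNIV::bool set). G \<inter> ?A k = {} \<or> G \<subseteq> ?U k)}"
  have \<gamma>: "open_cover Y ?\<gamma>"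
    using assms(3) AB UV by (intro fine_open_cover) (fastforce split: if_splits)+
  have \<omega>: "open_cover X (P ` I \<union> Q ` I)"
  proof -
    have sides: "openin X W" if "W \<in> P ` I \<union> Q ` I" for W
      using that PQ by auto
    moreover have "\<Union>(P ` I \<union> Q ` I) \<subseteq> topspace X"
      using sides by (meson Sup_least openin_subset)
    moreover have "topspace X \<subseteq> \<Union>(P ` I \<union> Q ` I)"
      using cover by auto
    ultimately show ?thesis
      unfolding open_cover_def by (meson subset_antisym)
  qed
  then have "locally_finite_in X (P ` I \<union> Q ` I)"
    using assms(3) by (intro finite_imp_locally_finite_in) (auto simp: open_cover_def)
  then obtain f where f: "surjective_map X Y f" "omega_map X Y (P ` I \<union> Q ` I) f"
    "cover_close X ?\<gamma> r f"
    using assms(2) \<omega> \<gamma> unfolding refinable_map_def by meson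
  have close: "r x \<in> ?U k" if k: "k \<in> I \<times> UNIV" and x: "x \<in> topspace X" and fx: "f x \<in> ?A k" for k x
  proof -
    obtain G where G: "G \<in> ?\<gamma>" "r x \<in> G" "f x \<in> G"
      using f(3) x unfolding cover_close_def by meson
    then have "G \<inter> ?A k = {} \<or> G \<subseteq> ?U k"
      using k by blast
    then show ?thesis
      using G(2,3) fx by blast
  qed
  have fA: "x \<in> P i" if "i \<in> I" "x \<in> topspace X" "f x \<in> A i" for i x
    using close[of "(i, True)" x] pre[OF that(1)] that by auto
  have fB: "x \<in> Q i" if "i \<in> I" "x \<in> topspace X" "f x \<in> B i" for i x
    using close[of "(i, False)" x] pre[OF that(1)] that by auto
  have disj: "P i \<inter> Q i = {}" if "i \<in> I" for i
    using PQ[OF that] by simp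
  obtain G H where GH: "\<forall>i\<in>I. openin Y (G i) \<and> openin Y (H i) \<and> G i \<inter> H i = {} \<and>
      {x \<in> topspace X. f x \<in> G i} \<subseteq> P i \<and> {x \<in> topspace X. f x \<in> H i} \<subseteq> Q i"
    and GHcover: "topspace Y \<subseteq> (\<Union>i\<in>I. G i \<union> H i)"
    by (rule exE[OF omega_map_open_sides[OF f(1,2) disj]]) (assumption, elim exE conjE, rule that)
  have miss: "A i \<inter> H i = {} \<and> B i \<inter> G i = {}" if i: "i \<in> I" for i
  proof -
    have preGH: "{x \<in> topspace X. f x \<in> G i} \<subseteq> P i" "{x \<in> topspace X. f x \<in> H i} \<subseteq> Q i"
      using GH i by simp_all
    have "A i \<union> B i \<subseteq> f ` topspace X"
      using AB[OF i] closedin_subset f(1) unfolding surjective_map_def by (metis Un_least)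
    moreover have "f x \<notin> A i \<inter> H i" "f x \<notin> B i \<inter> G i" if "x \<in> topspace X" for x
      using fA[OF i that] fB[OF i that] preGH disj[OF i] that by auto
    ultimately show ?thesis
      by blast
  qed
  show ?thesis
    using AB GH by (intro separators_from_open_sides[OF assms(1,3) _ _ miss GHcover]) simp_all
qed

theorem theorem4p1:
  fixes X :: "'a topology" and Y :: "'b topology" and r :: "'a \<Rightarrow> 'b"
  assumes "normal_space X"
    and "normal_space Y"
    and "paracompact_space Y"
    and "refinable_map X Y r"
    and "S_weakly_infinite_dimensional X"
  shows "S_weakly_infinite_dimensional Y"
  unfolding S_weakly_infinite_dimensional_def
proof (intro allI impI)
  fix A B :: "nat \<Rightarrow> 'b set"
  assume AB: "\<forall>i\<ge>1. closedin Y (A i) \<and> closedin Y (B i) \<and> A i \<inter> B i = {}"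
  have r: "continuous_map X Y r"
    using assms(4) unfolding refinable_map_def surjective_map_def by blast
  have "\<exists>U V. openin Y U \<and> openin Y V \<and> A i \<subseteq> U \<and> B i \<subseteq> V \<and>
      Y closure_of U \<inter> Y closure_of V = {}" if "i \<ge> 1" for i
    using assms(2) AB that unfolding normal_space_disjoint_closures disjnt_def by meson
  then obtain U V where UV: "\<And>i. i \<ge> 1 \<Longrightarrow> openin Y (U i) \<and> openin Y (V i) \<and> A i \<subseteq> U i \<and>
      B i \<subseteq> V i \<and> Y closure_of (U i) \<inter> Y closure_of (V i) = {}"
    by metis
  define K where "K S = {x \<in> topspace X. r x \<in> Y closure_of S}" for S
  have "closedin X (K S)" for S
    unfolding K_def using closedin_continuous_map_preimage[OF r closedin_closure_of] .
  moreover have "K (U i) \<inter> K (V i) = {}" if "i \<ge> 1" for i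
    unfolding K_def using UV[OF that] by blast
  ultimately have "\<exists>D. (\<forall>i\<ge>1. separator X (K (U i)) (K (V i)) (D i)) \<and>
      (\<exists>n\<ge>1. (\<Inter>i\<in>{1..n}. D i) = {})"
    by (intro assms(5)[unfolded S_weakly_infinite_dimensional_def, rule_format]) simp
  then obtain D n where D: "\<And>i. i \<ge> 1 \<Longrightarrow> separator X (K (U i)) (K (V i)) (D i)"
    and n: "n \<ge> 1" "(\<Inter>i\<in>{1..n}. D i) = {}"
    by meson
  have "\<exists>P Q. openin X P \<and> openin X Q \<and> P \<inter> Q = {} \<and> topspace X - D i = P \<union> Q \<and>
      K (U i) \<subseteq> P \<and> K (V i) \<subseteq> Q" if "i \<ge> 1" for i
    using D[OF that] unfolding separator_def by (rule conjunct2)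
  then obtain P Q where PQ: "\<And>i. i \<ge> 1 \<Longrightarrow> openin X (P i) \<and> openin X (Q i) \<and> P i \<inter> Q i = {} \<and>
      topspace X - D i = P i \<union> Q i \<and> K (U i) \<subseteq> P i \<and> K (V i) \<subseteq> Q i"
    by metis
  have cover: "topspace X \<subseteq> (\<Union>i\<in>{1..n}. P i \<union> Q i)"
  proof
    fix x assume x: "x \<in> topspace X"
    obtain i where "i \<in> {1..n}" "x \<notin> D i" using n(2) by blast
    then show "x \<in> (\<Union>i\<in>{1..n}. P i \<union> Q i)"
      using PQ[of i] x by (metis DiffI UN_I atLeastAtMost_iff)
  qed
  have pre: "{x \<in> topspace X. r x \<in> U i} \<subseteq> P i \<and> {x \<in> topspace X. r x \<in> V i} \<subseteq> Q i"
    if "i \<ge> 1" for i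
  proof -
    have "U i \<subseteq> Y closure_of (U i)" "V i \<subseteq> Y closure_of (V i)"
      using UV[OF that] by (auto intro!: closure_of_subset openin_subset)
    then show ?thesis
      using PQ[OF that] unfolding K_def by blast
  qed
  have "\<exists>C. (\<forall>i\<in>{1..n}. separator Y (A i) (B i) (C i)) \<and> topspace Y \<inter> (\<Inter>i\<in>{1..n}. C i) = {}"
    by (rule refinable_map_finite_separators[OF assms(2,4), where U = U and V = V and P = P and Q = Q])
      (use AB UV PQ pre cover in auto)
  then obtain C where C: "\<And>i. i \<in> {1..n} \<Longrightarrow> separator Y (A i) (B i) (C i)"
    "topspace Y \<inter> (\<Inter>i\<in>{1..n}. C i) = {}"
    by blast
  have "\<exists>E. separator Y (A i) (B i) E" if "i \<ge> 1" for i
    using normal_space_separator_avoiding[OF assms(2)] AB that by metis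
  then obtain E where E: "\<And>i. i \<ge> 1 \<Longrightarrow> separator Y (A i) (B i) (E i)"
    by metis
  let ?C = "\<lambda>i. if i \<le> n then C i else E i"
  have "separator Y (A i) (B i) (?C i)" if "i \<ge> 1" for i
    using C(1) E that by auto
  moreover have "(\<Inter>i\<in>{1..n}. ?C i) = {}"
  proof -
    have "C 1 \<subseteq> topspace Y"
      using C(1)[of 1] n(1) closedin_subset unfolding separator_def by auto
    then show ?thesis
      using C(2) n(1) by fastforce
  qed
  ultimately show "\<exists>C. (\<forall>i\<ge>1. separator Y (A i) (B i) (C i)) \<and>
      (\<exists>n\<ge>1. (\<Inter>i\<in>{1..n}. C i) = {})"
    using n(1) by (intro exI[of _ ?C] conjI exI[of _ n] allI impI)
qed

end
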